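(* Let $P$ be a set of $n$ points in the plane, $t>1$, $t'\ge t$, and let $k$ and $h$ be positive integers that are fixed (independent of $n$). Then the graph $H$ output by \textsc{Fast-Sparse-Spanner}$(P,t,t',k,h)$ is a geometric graph on $P$ with $O(n)$ edges.
   Context: All graphs are Euclidean: vertices are points and an edge $\{u,v\}$ has weight $|uv|$ (Euclidean distance). A $t$-path for $u,v$ in a graph $H$ is a path between $u$ and $v$ of total length at most $t|uv|$. Region quad-tree with leaf capacity $k$: the root corresponds to the bounding box of $P$; any node whose square contains more than $k$ points of $P$ is split into four equal quadrants (four children), recursively; nodes with at most $k$ points are leaves. The dual graph $G_T$ has the leaves of $T$ as vertices, two leaves adjacent iff their squares intersect. \textsc{FG-Greedy}$(Q,t)$ outputs the greedy $t$-spanner on $Q$: sort all pairs of $Q$ by distance; starting from the empty graph, for each pair $\{p,q\}$ in nondecreasing order, add edge $\{p,q\}$ if the current shortest-path distance between $p,q$ exceeds $t|pq|$. WSPD $t'$-spanner on a point set $S$: compute a well-separated pair decomposition $\{A_i,B_i\}_{i=1}^m$ of $S$ with separation ratio $s=4(t'+1)/(t'-1)$ (pairs of sets enclosed in congruent disjoint disks at distance at least $s$ times the common radius, such that every pair of distinct points is separated by exactly one pair), and add one edge $\{a_i,b_i\}$ with $a_i\in A_i,b_i\in B_i$ for each $i$; it has $O(|S|)$ edges. \textsc{Fast-Sparse-Spanner}$(P,t,t',k,h)$: (1) Build the quad-tree $T$ on $P$ with leaf capacity $k$; start with $H$ empty on $P$. (2) For every non-empty leaf $\sigma$, let $P_\sigma=P\cap\sigma$,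 add all edges of \textsc{FG-Greedy}$(P_\sigma,t)$ to $H$, and let the leader $\ell_\sigma$ be a point of $P_\sigma$ closest to the center of the bounding box of $P_\sigma$. (3) Add to $H$ the edges of a WSPD $t'$-spanner on the set of leaders. (4) For every pair of adjacent non-empty leaves $\sigma_i,\sigma_j$ of $G_T$ not yet merged, merge them. (5) For $i=2,\dots,h$, for every non-empty leaf $\sigma$ and every non-empty leaf $\sigma'$ at exactly $i$ hops from $\sigma$ in $G_T$, merge them if not yet merged. Merging $\sigma_i,\sigma_j$ with point sets $P_i,P_j$: process the pairs $(u,v)\in P_i\times P_j$ in some order (sorted by distance, or by a cheaper sorting heuristic), maintaining a set of "bridges" (paths in $H$ from a point of $P_i$ to a point of $P_j$, initialized possibly with the leader edge $\{\ell_{\sigma_i},\ell_{\sigma_j}\}$ if present); a pair is skipped if some bridge $x\leadsto y$ satisfies $t|ux|+|x\leadsto y|+t|yv|\le t|uv|$; otherwise a path from $u$ to $v$ in $H$ is sought, first by a greedy walk (repeatedly moving from the current vertex $y$ to an unvisited neighbor $x$ minimizing $|yx|+|xv|$), then by an $A^*$ shortest path computation; if a $t$-path is found it is added to the bridges, otherwise the edge $\{u,v\}$ is added to $H$ (and to the bridges). *)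

theory Defs
  imports "HOL-Analysis.Analysis"
begin

text \<open>Points in the Euclidean plane; the product metric on real \<times> real is Euclidean.
  A (geometric) graph is represented by its edge set: a set of 2-element sets of points.\<close>

type_synonym pt = "real \<times> real"

definition is_walk :: "pt set set \<Rightarrow> pt list \<Rightarrow> pt \<Rightarrow> pt \<Rightarrow> bool" where
  "is_walk E xs u v \<longleftrightarrow> xs \<noteq> [] \<and> hd xs = u \<and> last xs = v \<and>
     (\<forall>i < length xs - 1. {xs ! i, xs ! Suc i} \<in> E)"

definition walk_len :: "pt list \<Rightarrow> real" where
  "walk_len xs = (\<Sum>i < length xs - 1. dist (xs ! i) (xs ! Suc i))"

definition path_le :: "pt set set \<Rightarrow> pt \<Rightarrow> pt \<Rightarrow> real \<Rightarrow> bool" where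
  "path_le E u v L \<longleftrightarrow> (\<exists>xs. is_walk E xs u v \<and> walk_len xs \<le> L)"

definition greedy_step :: "real \<Rightarrow> pt set set \<Rightarrow> pt \<times> pt \<Rightarrow> pt set set" where
  "greedy_step t E pq = (case pq of (p, q) \<Rightarrow>
     (if path_le E p q (t * dist p q) then E else insert {p, q} E))"

definition fg_greedy_out :: "real \<Rightarrow> pt set \<Rightarrow> pt set set \<Rightarrow> bool" where
  "fg_greedy_out t Q E \<longleftrightarrow> (\<exists>ps.
     distinct (map (\<lambda>(p, q). {p, q}) ps) \<and>
     set (map (\<lambda>(p, q). {p, q}) ps) = {{p, q} | p q. p \<in> Q \<and> q \<in> Q \<and> p \<noteq> q} \<and>
     sorted (map (\<lambda>(p, q). dist p q) ps) \<and>
     E = foldl (greedy_step t) {} ps)"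

text \<open>Root square: the bounding square of P with lower-left corner (min x, min y) and side
  max(width, height). A cell (d,i,j) is the i-th column / j-th row square at depth d.
  Points are assigned to cells with half-open convention (top/right border of the root closed).\<close>

type_synonym cell = "nat \<times> nat \<times> nat"

definition qx0 :: "pt set \<Rightarrow> real" where "qx0 P = Min (fst ` P)"
definition qy0 :: "pt set \<Rightarrow> real" where "qy0 P = Min (snd ` P)"
definition qside :: "pt set \<Rightarrow> real" where
  "qside P = max (Max (fst ` P) - qx0 P) (Max (snd ` P) - qy0 P)"

definition cell_of :: "pt set \<Rightarrow> nat \<Rightarrow> pt \<Rightarrow> nat \<times> nat" where
  "cell_of P d p = (let s = qside P / 2 ^ d in
     (min (2 ^ d - 1) (nat \<lfloor>(fst p - qx0 P) / s\<rfloor>),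
      min (2 ^ d - 1) (nat \<lfloor>(snd p - qy0 P) / s\<rfloor>)))"

definition cell_pts :: "pt set \<Rightarrow> cell \<Rightarrow> pt set" where
  "cell_pts P c = (case c of (d, i, j) \<Rightarrow> {p \<in> P. cell_of P d p = (i, j)})"

definition cell_sq :: "pt set \<Rightarrow> cell \<Rightarrow> pt set" where
  "cell_sq P c = (case c of (d, i, j) \<Rightarrow> (let s = qside P / 2 ^ d in
     {x. qx0 P + real i * s \<le> fst x \<and> fst x \<le> qx0 P + real (Suc i) * s \<and>
         qy0 P + real j * s \<le> snd x \<and> snd x \<le> qy0 P + real (Suc j) * s}))"

text \<open>A cell is a node of the quad-tree iff all its proper ancestors contain more than k points.\<close>
definition qt_node :: "pt set \<Rightarrow> nat \<Rightarrow> cell \<Rightarrow> bool" where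
  "qt_node P k c = (case c of (d, i, j) \<Rightarrow> i < 2 ^ d \<and> j < 2 ^ d \<and>
     (\<forall>d' < d. k < card (cell_pts P (d', i div 2 ^ (d - d'), j div 2 ^ (d - d')))))"

definition qt_leaf :: "pt set \<Rightarrow> nat \<Rightarrow> cell \<Rightarrow> bool" where
  "qt_leaf P k c \<longleftrightarrow> qt_node P k c \<and> card (cell_pts P c) \<le> k"

definition qt_adj :: "pt set \<Rightarrow> nat \<Rightarrow> (cell \<times> cell) set" where
  "qt_adj P k = {(c, c'). qt_leaf P k c \<and> qt_leaf P k c' \<and> c \<noteq> c' \<and>
                          cell_sq P c \<inter> cell_sq P c' \<noteq> {}}"

definition hop_eq :: "pt set \<Rightarrow> nat \<Rightarrow> nat \<Rightarrow> cell \<Rightarrow> cell \<Rightarrow> bool" where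
  "hop_eq P k m c c' \<longleftrightarrow> (c, c') \<in> qt_adj P k ^^ m \<and> (\<forall>m' < m. (c, c') \<notin> qt_adj P k ^^ m')"

definition hops :: "pt set \<Rightarrow> nat \<Rightarrow> cell \<Rightarrow> cell \<Rightarrow> nat" where
  "hops P k c c' = (LEAST m. (c, c') \<in> qt_adj P k ^^ m)"

definition bbox_center :: "pt set \<Rightarrow> pt" where
  "bbox_center Q = ((Min (fst ` Q) + Max (fst ` Q)) / 2, (Min (snd ` Q) + Max (snd ` Q)) / 2)"

definition is_leader :: "pt set \<Rightarrow> pt \<Rightarrow> bool" where
  "is_leader Q l \<longleftrightarrow> l \<in> Q \<and> (\<forall>q \<in> Q. dist l (bbox_center Q) \<le> dist q (bbox_center Q))"

definition well_sep :: "real \<Rightarrow> pt set \<Rightarrow> pt set \<Rightarrow> bool" where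
  "well_sep s A B \<longleftrightarrow> (\<exists>c1 c2 r. 0 \<le> r \<and> A \<subseteq> cball c1 r \<and> B \<subseteq> cball c2 r \<and>
      cball c1 r \<inter> cball c2 r = {} \<and> dist c1 c2 - 2 * r \<ge> s * r)"

definition is_wspd :: "real \<Rightarrow> pt set \<Rightarrow> (pt set \<times> pt set) list \<Rightarrow> bool" where
  "is_wspd s S ws \<longleftrightarrow>
     (\<forall>(A, B) \<in> set ws. A \<noteq> {} \<and> B \<noteq> {} \<and> A \<subseteq> S \<and> B \<subseteq> S \<and> well_sep s A B) \<and>
     (\<forall>p \<in> S. \<forall>q \<in> S. p \<noteq> q \<longrightarrow>
        (\<exists>!i. i < length ws \<and> ((p \<in> fst (ws ! i) \<and> q \<in> snd (ws ! i)) \<or>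
                                 (q \<in> fst (ws ! i) \<and> p \<in> snd (ws ! i)))))"

inductive run :: "('s \<Rightarrow> 'x \<Rightarrow> 's \<Rightarrow> bool) \<Rightarrow> 's \<Rightarrow> 'x list \<Rightarrow> 's \<Rightarrow> bool" for step where
  run_Nil: "run step s [] s"
| run_Cons: "step s x s' \<Longrightarrow> run step s' xs s'' \<Longrightarrow> run step s (x # xs) s''"

text \<open>State: (edges of H, bridges). A bridge (x,y,L) records a path in H from x to y of length L.\<close>
definition bridge_step :: "real \<Rightarrow> pt set set \<times> (pt \<times> pt \<times> real) set \<Rightarrow> pt \<times> pt
                           \<Rightarrow> pt set set \<times> (pt \<times> pt \<times> real) set \<Rightarrow> bool" where
  "bridge_step t st uv st' = (case st of (E, B) \<Rightarrow> case uv of (u, v) \<Rightarrow>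
     (if (\<exists>(x, y, L) \<in> B. t * dist u x + L + t * dist y v \<le> t * dist u v) then st' = (E, B)
      else if path_le E u v (t * dist u v)
      then (\<exists>xs. is_walk E xs u v \<and> walk_len xs \<le> t * dist u v \<and>
                 st' = (E, insert (u, v, walk_len xs) B))
      else st' = (insert {u, v} E, insert (u, v, dist u v) B)))"

definition merge_step :: "pt set \<Rightarrow> real \<Rightarrow> (cell \<Rightarrow> pt) \<Rightarrow> pt set set \<Rightarrow> cell \<times> cell
                          \<Rightarrow> pt set set \<Rightarrow> bool" where
  "merge_step P t ldr E cc E' = (case cc of (c, c') \<Rightarrow>
     (\<exists>us B0 B. distinct us \<and> set us = cell_pts P c \<times> cell_pts P c' \<and>
        (B0 = {} \<or> ({ldr c, ldr c'} \<in> E \<and> B0 = {(ldr c, ldr c', dist (ldr c) (ldr c'))})) \<and>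
        run (bridge_step t) (E, B0) us (E', B)))"

text \<open>H is a possible output of Fast-Sparse-Spanner(P,t,t',k,h), where the WSPD subroutine
  produces a WSPD with at most cW * |S| pairs (the O(|S|) size guarantee).\<close>
definition nonempty_leaves :: "pt set \<Rightarrow> nat \<Rightarrow> cell set" where
  "nonempty_leaves P k = {c. qt_leaf P k c \<and> cell_pts P c \<noteq> {}}"

definition fss_output :: "pt set \<Rightarrow> real \<Rightarrow> real \<Rightarrow> nat \<Rightarrow> nat \<Rightarrow> real \<Rightarrow> pt set set \<Rightarrow> bool" where
  "fss_output P t t' k h cW H \<longleftrightarrow>
   (\<exists>(G :: cell \<Rightarrow> pt set set) (ldr :: cell \<Rightarrow> pt) ws (a :: nat \<Rightarrow> pt) (b :: nat \<Rightarrow> pt)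
      (ms :: (cell \<times> cell) list).
      (\<forall>c \<in> nonempty_leaves P k. fg_greedy_out t (cell_pts P c) (G c)) \<and>
      (\<forall>c \<in> nonempty_leaves P k. is_leader (cell_pts P c) (ldr c)) \<and>
      is_wspd (4 * (t' + 1) / (t' - 1)) (ldr ` nonempty_leaves P k) ws \<and>
      real (length ws) \<le> cW * real (card (ldr ` nonempty_leaves P k)) \<and>
      (\<forall>i < length ws. a i \<in> fst (ws ! i) \<and> b i \<in> snd (ws ! i)) \<and>
      distinct (map (\<lambda>(c, c'). {c, c'}) ms) \<and>
      set (map (\<lambda>(c, c'). {c, c'}) ms) =
        {{c, c'} | c c' m. c \<in> nonempty_leaves P k \<and> c' \<in> nonempty_leaves P k \<and>
                          1 \<le> m \<and> m \<le> h \<and> hop_eq P k m c c'} \<and>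
      sorted (map (\<lambda>(c, c'). hops P k c c') ms) \<and>
      run (merge_step P t ldr)
          ((\<Union>c \<in> nonempty_leaves P k. G c) \<union> {{a i, b i} | i. i < length ws}) ms H)"

end

theory Submission
  imports Defs
begin

text \<open>The number of merged leaf pairs can be quadratic, since a large leaf may be adjacent to
  linearly many small ones, so the merge edges are counted by packing instead of by hops. The greedy
  edges inside the leaves and the WSPD edges between the leaders already connect any two points of a
  common depth-\<open>D\<close> grid cell by a walk of length \<open>O(t')\<close> times the cell side \<open>w\<close>: either both lie in
  one leaf, or both leaves are deeper than \<open>D\<close> and hence have diameter \<open>O(w)\<close>, so that the detour
  through their leaders is short. Consequently two merge edges whose endpoints pairwise share cells
  of side \<open>O((t - 1) / t')\<close> times their lengths cannot coexist, because the first one would provide a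
  \<open>t\<close>-path for the second. An edge set with this separation property has linear size: charge every
  edge to a point of a farthest-first net at the scale of its length; each point is charged by
  boundedly many edges.\<close>

section \<open>Walks and spanners\<close>

lemma path_le_refl: "0 \<le> L \<Longrightarrow> path_le E u u L"
  unfolding path_le_def by (rule exI[of _ "[u]"]) (simp add: is_walk_def walk_len_def)

lemma is_walk_mono: "is_walk E xs u v \<Longrightarrow> E \<subseteq> E' \<Longrightarrow> is_walk E' xs u v"
  unfolding is_walk_def by blast

lemma path_le_mono: "path_le E u v L \<Longrightarrow> E \<subseteq> E' \<Longrightarrow> L \<le> L' \<Longrightarrow> path_le E' u v L'"
  unfolding path_le_def by (meson is_walk_mono order_trans)

lemma is_walk_Cons2:
  "is_walk E (x # y # zs) u v \<longleftrightarrow> u = x \<and> {x, y} \<in> E \<and> is_walk E (y # zs) y v"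
  by (auto simp: is_walk_def nth_Cons less_Suc_eq_0_disj split: nat.splits)

lemma walk_len_Cons2: "walk_len (x # y # zs) = dist x y + walk_len (y # zs)"
  by (simp add: walk_len_def sum.lessThan_Suc_shift del: sum.lessThan_Suc)

lemma path_le_Cons:
  assumes "{x, y} \<in> E" "path_le E y v L" "dist x y + L \<le> L'"
  shows "path_le E x v L'"
proof -
  obtain xs where xs: "is_walk E xs y v" "walk_len xs \<le> L"
    using assms(2) by (auto simp: path_le_def)
  then obtain zs where "xs = y # zs"
    by (cases xs) (auto simp: is_walk_def)
  with xs assms show ?thesis
    unfolding path_le_def
    by (intro exI[of _ "x # y # zs"]) (auto simp: is_walk_Cons2 walk_len_Cons2)
qed

lemma path_le_edge: "{u, v} \<in> E \<Longrightarrow> dist u v \<le> L \<Longrightarrow> path_le E u v L"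
  by (rule path_le_Cons[OF _ path_le_refl[of 0]]) auto

lemma path_le_trans_walk:
  "is_walk E xs u v \<Longrightarrow> path_le E v w L \<Longrightarrow> path_le E u w (walk_len xs + L)"
proof (induction xs arbitrary: u)
  case Nil
  then show ?case by (simp add: is_walk_def)
next
  case (Cons x xs)
  show ?case
  proof (cases xs)
    case Nil
    with Cons.prems show ?thesis by (auto simp: is_walk_def walk_len_def)
  next
    case (Cons y zs)
    with Cons.prems Cons.IH[of y] show ?thesis
      by (auto simp: is_walk_Cons2 walk_len_Cons2 intro: path_le_Cons)
  qed
qed

lemma path_le_trans:
  "path_le E u v L \<Longrightarrow> path_le E v w L' \<Longrightarrow> L + L' \<le> L'' \<Longrightarrow> path_le E u w L''"
  unfolding path_le_def[of E u v]
  by (auto intro: path_le_mono[OF path_le_trans_walk])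

lemma path_le_sym_walk: "is_walk E xs u v \<Longrightarrow> path_le E v u (walk_len xs)"
proof (induction xs arbitrary: u)
  case Nil
  then show ?case by (simp add: is_walk_def)
next
  case (Cons x xs)
  show ?case
  proof (cases xs)
    case Nil
    with Cons.prems show ?thesis by (auto simp: is_walk_def walk_len_def intro: path_le_refl)
  next
    case (Cons y zs)
    with Cons.prems have *: "u = x" "{x, y} \<in> E" "is_walk E xs y v"
      by (auto simp: is_walk_Cons2)
    have "path_le E y x (dist x y)"
      using *(2) by (intro path_le_edge) (auto simp: insert_commute dist_commute)
    then show ?thesis
      unfolding * by (rule path_le_trans[OF Cons.IH[OF *(3)]])
        (simp add: * Cons walk_len_Cons2)
  qed
qed

lemma path_le_sym: "path_le E u v L \<Longrightarrow> path_le E v u L"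
  by (auto simp: path_le_def[of E u v] intro: path_le_mono[OF path_le_sym_walk])

section \<open>Greedy and well-separated-pair spanners\<close>

lemma greedy_fold_mono: "E \<subseteq> foldl (greedy_step t) E ps"
proof (induction ps arbitrary: E)
  case (Cons pq ps)
  have "E \<subseteq> greedy_step t E pq" by (auto simp: greedy_step_def split: prod.splits)
  with Cons[of "greedy_step t E pq"] show ?case by auto
qed simp

lemma greedy_fold_subset:
  "foldl (greedy_step t) E ps \<subseteq> E \<union> set (map (\<lambda>(p, q). {p, q}) ps)"
proof (induction ps arbitrary: E)
  case (Cons pq ps)
  have "greedy_step t E pq \<subseteq> insert (case pq of (p, q) \<Rightarrow> {p, q}) E"
    by (auto simp: greedy_step_def split: prod.splits if_splits)
  with Cons[of "greedy_step t E pq"] show ?case by auto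
qed simp

text \<open>When \<open>(p, q)\<close> is processed, a short path exists or the edge is inserted;
  later steps only add edges.\<close>

lemma greedy_fold_path:
  assumes "1 \<le> t" "(p, q) \<in> set ps"
  shows "path_le (foldl (greedy_step t) E ps) p q (t * dist p q)"
  using assms(2)
proof (induction ps arbitrary: E)
  case (Cons pq ps)
  show ?case
  proof (cases "pq = (p, q)")
    case True
    have "dist p q \<le> t * dist p q"
      using assms(1) mult_right_mono[of 1 t "dist p q"] by simp
    then have "path_le (greedy_step t E pq) p q (t * dist p q)"
      by (auto simp: True greedy_step_def intro: path_le_edge)
    then show ?thesis
      by (simp add: path_le_mono[OF _ greedy_fold_mono order_refl])
  next
    case False
    with Cons show ?thesis by simp
  qed
qed simp

lemma fg_greedy_subset:
  assumes "fg_greedy_out t Q E"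
  shows "E \<subseteq> {{p, q} | p q. p \<in> Q \<and> q \<in> Q \<and> p \<noteq> q}"
proof -
  obtain ps where "E = foldl (greedy_step t) {} ps"
    "set (map (\<lambda>(p, q). {p, q}) ps) = {{p, q} | p q. p \<in> Q \<and> q \<in> Q \<and> p \<noteq> q}"
    using assms unfolding fg_greedy_out_def by blast
  with greedy_fold_subset[of t "{}" ps] show ?thesis by simp
qed

lemma fg_greedy_spanner:
  assumes "fg_greedy_out t Q E" "1 \<le> t" "p \<in> Q" "q \<in> Q"
  shows "path_le E p q (t * dist p q)"
proof (cases "p = q")
  case True
  then show ?thesis by (simp add: path_le_refl)
next
  case False
  obtain ps where ps: "E = foldl (greedy_step t) {} ps"
    "(\<lambda>(p, q). {p, q}) ` set ps = {{p, q} | p q. p \<in> Q \<and> q \<in> Q \<and> p \<noteq> q}"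
    using assms(1) by (auto simp: fg_greedy_out_def)
  have "{p, q} \<in> (\<lambda>(p, q). {p, q}) ` set ps"
    unfolding ps(2) using assms False by blast
  then have "(p, q) \<in> set ps \<or> (q, p) \<in> set ps"
    by (auto simp: doubleton_eq_iff)
  then show ?thesis
    using greedy_fold_path[OF assms(2), of p q ps "{}"] greedy_fold_path[OF assms(2), of q p ps "{}"]
    unfolding ps(1) by (auto simp: dist_commute intro: path_le_sym)
qed

text \<open>Induction on the distance: \<open>p\<close> and \<open>q\<close> are joined through the
  representatives of the pair separating them. The two end pieces are shorter than
  \<open>dist p q\<close>, so the induction hypothesis covers them.\<close>

lemma wspd_spanner:
  assumes "finite S" "1 < t" "is_wspd (4 * (t + 1) / (t - 1)) S ws"
    and ab: "\<forall>i < length ws. a i \<in> fst (ws ! i) \<and> b i \<in> snd (ws ! i)"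
    and "p \<in> S" "q \<in> S"
  shows "path_le {{a i, b i} | i. i < length ws} p q (t * dist p q)"
  using \<open>p \<in> S\<close> \<open>q \<in> S\<close>
\<comment> \<open>The rank of \<open>dist p q\<close> among finitely many distances serves as a
  well-founded measure.\<close>
proof (induction "card {(x, y) \<in> S \<times> S. dist x y < dist p q}" arbitrary: p q rule: less_induct)
  case less
  let ?E = "{{a i, b i} | i. i < length ws}"
  have IH: "path_le ?E x y (t * dist x y)" if "x \<in> S" "y \<in> S" "dist x y < dist p q" for x y
  proof (rule less.hyps[OF _ that(1,2)])
    have "finite {(x, y) \<in> S \<times> S. dist x y < dist p q}"
      using \<open>finite S\<close> by (auto intro: rev_finite_subset[of "S \<times> S"])
    moreover have "(x, y) \<in> {(x, y) \<in> S \<times> S. dist x y < dist p q}"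
      using that by simp
    ultimately show "card {(x', y') \<in> S \<times> S. dist x' y' < dist x y}
        < card {(x, y) \<in> S \<times> S. dist x y < dist p q}"
      using that(3) by (intro psubset_card_mono) auto
  qed
  have sep: "path_le ?E x y (t * dist x y)"
    if "i < length ws" "x \<in> fst (ws ! i)" "y \<in> snd (ws ! i)" "dist x y = dist p q" for i x y
  proof -
    have "(fst (ws ! i), snd (ws ! i)) \<in> set ws" using that(1) by simp
    then have sub: "fst (ws ! i) \<subseteq> S" "snd (ws ! i) \<subseteq> S"
      and ws: "well_sep (4 * (t + 1) / (t - 1)) (fst (ws ! i)) (snd (ws ! i))"
      using assms(3) unfolding is_wspd_def by blast+
    obtain c1 c2 r where r: "0 \<le> r" "fst (ws ! i) \<subseteq> cball c1 r" "snd (ws ! i) \<subseteq> cball c2 r"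
      "cball c1 r \<inter> cball c2 r = {}" "4 * (t + 1) / (t - 1) * r \<le> dist c1 c2 - 2 * r"
      using ws by (auto simp: well_sep_def)
    have a: "a i \<in> fst (ws ! i)" and b: "b i \<in> snd (ws ! i)" using ab that(1) by auto
    have d: "dist c1 x \<le> r" "dist c1 (a i) \<le> r" "dist c2 y \<le> r" "dist c2 (b i) \<le> r"
      using r that(2,3) a b by auto
    have "dist c1 c2 \<le> dist c1 x + dist x y + dist c2 y"
      using dist_triangle[of c1 c2 x] dist_triangle[of x c2 y] by (simp add: dist_commute)
    then have lower: "4 * (t + 1) / (t - 1) * r \<le> dist x y"
      using r(5) d by simp
    \<comment> \<open>The separation ratio is made for this: beyond \<open>dist x y\<close> the
      detour costs \<open>2 * t * r\<close> at each end and \<open>4 * r\<close> on the middle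
      edge.\<close>
    have "4 * (t + 1) * r \<le> (t - 1) * dist x y"
      using lower \<open>1 < t\<close> by (simp add: field_simps)
    then have budget: "4 * t * r + 4 * r \<le> t * dist x y - dist x y"
      by (simp add: algebra_simps)
    \<comment> \<open>The radius may be 0, so the strict bound \<open>2 * r < dist x y\<close> takes
      positivity from the disjointness of the disks.\<close>
    have "x \<noteq> y" using r(2,3,4) that(2,3) by auto
    then have pos: "0 < dist x y" by simp
    have "4 * r \<le> 4 * (t + 1) / (t - 1) * r"
      using \<open>1 < t\<close> r(1) by (intro mult_right_mono) (auto simp: field_simps)
    then have small: "2 * r < dist x y" using lower pos r(1) by linarith
    have xa: "dist x (a i) \<le> 2 * r" "dist (b i) y \<le> 2 * r"
      using d dist_triangle3[of x "a i" c1] dist_triangle3[of "b i" y c2] by auto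
    have "dist (a i) (b i) \<le> dist (a i) x + dist x y + dist y (b i)"
      using dist_triangle[of "a i" "b i" x] dist_triangle[of x "b i" y] by simp
    then have len: "dist (a i) (b i) \<le> dist x y + 4 * r"
      using xa by (simp add: dist_commute)
    have p1: "path_le ?E x (a i) (t * (2 * r))"
      using sub that a xa small \<open>1 < t\<close>
      by (intro path_le_mono[OF IH order_refl] mult_left_mono) auto
    have p2: "path_le ?E (b i) y (t * (2 * r))"
      using sub that b xa small \<open>1 < t\<close>
      by (intro path_le_mono[OF IH order_refl] mult_left_mono) auto
    have "path_le ?E (a i) y (dist x y + 4 * r + t * (2 * r))"
      by (rule path_le_Cons[OF _ p2]) (use that(1) len in auto)
    then show ?thesis
      by (rule path_le_trans[OF p1]) (use budget in \<open>simp add: algebra_simps\<close>)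
  qed
  show ?case
  proof (cases "p = q")
    case True
    then show ?thesis by (simp add: path_le_refl)
  next
    case False
    then obtain i where "i < length ws"
      "p \<in> fst (ws ! i) \<and> q \<in> snd (ws ! i) \<or> q \<in> fst (ws ! i) \<and> p \<in> snd (ws ! i)"
      using assms(3) less.prems unfolding is_wspd_def by blast
    then show ?thesis
      using sep[of i p q] path_le_sym[OF sep[of i q p]] by (auto simp: dist_commute[of q p])
  qed
qed

section \<open>Quad-tree cells\<close>

text \<open>One coordinate of \<open>cell_of\<close>, with \<open>x\<close> measured from the corner
  of the root square. The minimum moves the closed far border into the last cell.\<close>

definition grid_index :: "real \<Rightarrow> nat \<Rightarrow> real \<Rightarrow> nat" where
  "grid_index s d x = min (2 ^ d - 1) (nat \<lfloor>x / (s / 2 ^ d)\<rfloor>)"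

lemma cell_of_eq_grid_index:
  "cell_of P d p = (grid_index (qside P) d (fst p - qx0 P), grid_index (qside P) d (snd p - qy0 P))"
  by (simp add: cell_of_def grid_index_def Let_def)

lemma grid_index_bounds:
  assumes "0 < s" "0 \<le> x" "x \<le> s"
  shows "real (grid_index s d x) * (s / 2 ^ d) \<le> x"
    and "x \<le> real (Suc (grid_index s d x)) * (s / 2 ^ d)"
proof -
  let ?w = "s / 2 ^ d" and ?n = "nat \<lfloor>x / (s / 2 ^ d)\<rfloor>"
  have w: "0 < ?w" using assms by simp
  have "0 \<le> x / ?w" using w assms by simp
  then have n: "real ?n \<le> x / ?w" "x / ?w < real ?n + 1"
    by linarith+
  have "real (grid_index s d x) \<le> x / ?w"
    using n(1) by (simp add: grid_index_def)
  then show "real (grid_index s d x) * ?w \<le> x"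
    using w pos_le_divide_eq by blast
  \<comment> \<open>The cap does no harm inside the root square: the last cell ends at
    \<open>s\<close>.\<close>
  have "x / ?w \<le> 2 ^ d"
    using assms by (simp add: field_simps)
  then have "x / ?w \<le> real (Suc (grid_index s d x))"
    using n(2) by (auto simp: grid_index_def min_def of_nat_diff)
  then show "x \<le> real (Suc (grid_index s d x)) * ?w"
    using w pos_divide_le_eq by blast
qed

lemma grid_index_eq_imp_close:
  assumes "0 < s" "0 \<le> x" "x \<le> s" "0 \<le> y" "y \<le> s" "grid_index s d x = grid_index s d y"
  shows "\<bar>x - y\<bar> \<le> s / 2 ^ d"
proof -
  have "real (Suc (grid_index s d y)) * (s / 2 ^ d)
      = real (grid_index s d y) * (s / 2 ^ d) + s / 2 ^ d"
    by (simp only: of_nat_Suc distrib_right mult_1 add.commute)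
  then show ?thesis
    using grid_index_bounds[OF assms(1-3), of d] grid_index_bounds[OF assms(1,4,5), of d]
    unfolding assms(6) by linarith
qed

text \<open>Truncating at 0 and capping do not increase differences, and rounding down adds at most
  1.\<close>

lemma grid_index_Lipschitz:
  assumes "0 < s"
  shows "real_of_int \<bar>int (grid_index s d x) - int (grid_index s d y)\<bar> \<le> \<bar>x - y\<bar> / (s / 2 ^ d) + 1"
proof -
  let ?w = "s / 2 ^ d"
  have "\<bar>int (grid_index s d x) - int (grid_index s d y)\<bar> \<le> \<bar>\<lfloor>x / ?w\<rfloor> - \<lfloor>y / ?w\<rfloor>\<bar>"
    unfolding grid_index_def by linarith
  moreover have "real_of_int \<bar>\<lfloor>x / ?w\<rfloor> - \<lfloor>y / ?w\<rfloor>\<bar> \<le> \<bar>x / ?w - y / ?w\<bar> + 1"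
    by linarith
  moreover have "\<bar>x / ?w - y / ?w\<bar> = \<bar>x - y\<bar> / ?w"
    using assms by (metis abs_divide abs_of_pos diff_divide_distrib divide_pos_pos zero_less_numeral zero_less_power)
  ultimately show ?thesis by linarith
qed

text \<open>Rounding down is compatible with integer division, and so is the cap: division is
  monotone and sends \<open>2 ^ D - 1\<close> to \<open>2 ^ d - 1\<close>.\<close>

lemma grid_index_ancestor:
  assumes "d \<le> D"
  shows "grid_index s d x = grid_index s D x div 2 ^ (D - d)"
proof -
  let ?m = "2 ^ (D - d) :: nat"
  have pow: "(2::nat) ^ D = 2 ^ d * ?m" "(2::real) ^ D = 2 ^ d * 2 ^ (D - d)"
    using assms by (simp_all flip: power_add)
  have "x / (s / 2 ^ d) = x / (s / 2 ^ D) / real_of_int (int ?m)"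
    by (simp add: pow)
  then have "\<lfloor>x / (s / 2 ^ d)\<rfloor> = \<lfloor>x / (s / 2 ^ D)\<rfloor> div int ?m"
    by (simp only: floor_divide_real_eq_div)
  then have fl: "nat \<lfloor>x / (s / 2 ^ d)\<rfloor> = nat \<lfloor>x / (s / 2 ^ D)\<rfloor> div ?m"
    by (simp add: nat_div_distrib' nat_power_eq)
  have top: "(2 ^ D - 1) div ?m = 2 ^ d - 1"
  proof (rule div_nat_eqI)
    have "?m * (2 ^ d - 1) = 2 ^ D - ?m"
      by (simp add: pow algebra_simps)
    moreover have "1 \<le> ?m" "?m \<le> 2 ^ D" by (auto simp: pow)
    moreover have "?m * Suc (2 ^ d - 1) = 2 ^ D"
      by (simp add: pow)
    ultimately show "?m * (2 ^ d - 1) \<le> 2 ^ D - 1" "2 ^ D - 1 < ?m * Suc (2 ^ d - 1)"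
      by (metis diff_le_mono2, metis diff_less less_le_trans zero_less_one)
  qed
  have "mono (\<lambda>n. n div ?m)" by (simp add: mono_def div_le_mono)
  then show ?thesis
    unfolding grid_index_def fl top[symmetric] by (rule min_of_mono)
qed

lemma cell_of_ancestor:
  "d \<le> D \<Longrightarrow> cell_of P d p = (fst (cell_of P D p) div 2 ^ (D - d), snd (cell_of P D p) div 2 ^ (D - d))"
  by (simp add: cell_of_eq_grid_index grid_index_ancestor[of d D])

section \<open>Euclidean size of cells and position of leaves\<close>

lemma in_root_square:
  assumes "finite P" "p \<in> P"
  shows "0 \<le> fst p - qx0 P" "fst p - qx0 P \<le> qside P" "0 \<le> snd p - qy0 P" "snd p - qy0 P \<le> qside P"
  using assms
  by (auto simp: qx0_def qy0_def qside_def le_max_iff_disj)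

lemma qside_pos:
  assumes "finite P" "u \<in> P" "v \<in> P" "u \<noteq> v"
  shows "0 < qside P"
proof (rule ccontr)
  assume "\<not> 0 < qside P"
  then have "fst u = fst v" "snd u = snd v"
    using in_root_square[OF assms(1,2)] in_root_square[OF assms(1,3)] by linarith+
  with assms(4) show False by (simp add: prod_eq_iff)
qed

lemma dist_le_abs_diffs: "dist (p :: pt) q \<le> \<bar>fst p - fst q\<bar> + \<bar>snd p - snd q\<bar>"
  by (simp add: dist_prod_def dist_real_def sqrt_sum_squares_le_sum_abs)

lemma abs_diffs_le_dist: "\<bar>fst p - fst q\<bar> \<le> dist (p :: pt) q" "\<bar>snd p - snd q\<bar> \<le> dist (p :: pt) q"
  using dist_fst_le[of p q] dist_snd_le[of p q] by (simp_all add: dist_real_def)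

lemma same_cell_imp_close:
  assumes "finite P" "p \<in> P" "q \<in> P" "cell_of P d p = cell_of P d q"
  shows "dist p q \<le> 2 * (qside P / 2 ^ d)"
\<comment> \<open>If \<open>P\<close> is a single point, the root square has side 0 and the grid
  estimates do not apply.\<close>
proof (cases "p = q")
  case True
  have "0 \<le> qside P" using in_root_square[OF assms(1,2)] by linarith
  with True show ?thesis by simp
next
  case False
  note pos = qside_pos[OF assms(1-3) False]
  note p = in_root_square[OF assms(1,2)] and q = in_root_square[OF assms(1,3)]
  have "\<bar>(fst p - qx0 P) - (fst q - qx0 P)\<bar> \<le> qside P / 2 ^ d"
    using assms(4) by (intro grid_index_eq_imp_close pos p q) (simp add: cell_of_eq_grid_index)
  moreover have "\<bar>(snd p - qy0 P) - (snd q - qy0 P)\<bar> \<le> qside P / 2 ^ d"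
    using assms(4) by (intro grid_index_eq_imp_close pos p q) (simp add: cell_of_eq_grid_index)
  ultimately show ?thesis
    using dist_le_abs_diffs[of p q] by simp
qed

text \<open>If \<open>c\<close> were strictly shallower, it would be a proper ancestor of the node
  \<open>c'\<close> and so hold more than \<open>k\<close> points, which a leaf cannot.\<close>

lemma leaf_eq_if_shallower:
  assumes "qt_leaf P k c" "qt_leaf P k c'" "u \<in> cell_pts P c" "u' \<in> cell_pts P c'"
    and "cell_of P (fst c) u = cell_of P (fst c) u'" "fst c \<le> fst c'"
  shows "c = c'"
proof -
  obtain d i j d' i' j' where c: "c = (d, i, j)" "c' = (d', i', j')"
    by (metis prod_cases3)
  have u: "cell_of P d u = (i, j)" "cell_of P d' u' = (i', j')" "cell_of P d u' = (i, j)"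
    using assms by (auto simp: c cell_pts_def)
  have anc: "(i, j) = (i' div 2 ^ (d' - d), j' div 2 ^ (d' - d))"
    using cell_of_ancestor[of d d' P u'] assms(6) by (simp add: c u)
  have "\<not> d < d'"
    using assms(1,2) anc by (fastforce simp: qt_leaf_def qt_node_def c)
  with assms(6) u show ?thesis by (auto simp: c)
qed

text \<open>A leaf of depth at most \<open>D\<close> contains the whole depth-\<open>D\<close> cell
  of each of its points, so any leaf with a point in that cell coincides with it.\<close>

lemma leaf_eq_or_deeper:
  assumes "qt_leaf P k c" "qt_leaf P k c'" "u \<in> cell_pts P c" "u' \<in> cell_pts P c'"
    and "cell_of P D u = cell_of P D u'"
  shows "c = c' \<or> D < fst c \<and> D < fst c'"
proof (rule ccontr)
  assume neg: "\<not> ?thesis"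
  have "cell_of P d u = cell_of P d u'" if "d \<le> D" for d
    using cell_of_ancestor[OF that] assms(5) by simp
  then have eq: "fst c \<le> D \<Longrightarrow> cell_of P (fst c) u = cell_of P (fst c) u'"
    "fst c' \<le> D \<Longrightarrow> cell_of P (fst c') u' = cell_of P (fst c') u"
    by simp_all
  show False
  proof (cases "fst c \<le> fst c'")
    case True
    with neg eq(1) leaf_eq_if_shallower[OF assms(1-4)] show False by fastforce
  next
    case False
    with neg eq(2) leaf_eq_if_shallower[OF assms(2,1,4,3)] show False by fastforce
  qed
qed

lemma leaf_unique:
  assumes "qt_leaf P k c" "qt_leaf P k c'" "u \<in> cell_pts P c" "u \<in> cell_pts P c'"
  shows "c = c'"
  using leaf_eq_or_deeper[OF assms, of "fst c"] by simp

lemma leaf_close: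
  assumes "finite P" "u \<in> cell_pts P c" "v \<in> cell_pts P c" "D \<le> fst c"
  shows "dist u v \<le> 2 * (qside P / 2 ^ D)"
proof -
  obtain d i j where c: "c = (d, i, j)" by (metis prod_cases3)
  have "cell_of P D u = cell_of P D v"
    using assms cell_of_ancestor[of D d P] by (auto simp: c cell_pts_def)
  with assms show ?thesis
    by (intro same_cell_imp_close) (auto simp: c cell_pts_def)
qed

text \<open>Let \<open>w\<close> be the cell side. Within one leaf the greedy path suffices.
  Otherwise both leaves lie inside the cell, their leaders are at distance at most
  \<open>6 * w\<close>, and the walk through the leaders costs 2, 6 and 2 times
  \<open>t' * w\<close>.\<close>

lemma same_cell_path:
  assumes "finite P" "1 \<le> t" "t \<le> t'"
    and greedy: "\<And>c p q. c \<in> L \<Longrightarrow> p \<in> cell_pts P c \<Longrightarrow> q \<in> cell_pts P c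
        \<Longrightarrow> path_le E p q (t * dist p q)"
    and leaders: "\<And>c c'. c \<in> L \<Longrightarrow> c' \<in> L \<Longrightarrow> path_le E (ldr c) (ldr c') (t' * dist (ldr c) (ldr c'))"
    and ldr: "\<And>c. c \<in> L \<Longrightarrow> ldr c \<in> cell_pts P c"
    and leaf: "\<And>c. c \<in> L \<Longrightarrow> qt_leaf P k c"
    and u: "c \<in> L" "u \<in> cell_pts P c" and v: "c' \<in> L" "v \<in> cell_pts P c'"
    and same: "cell_of P D u = cell_of P D v"
  shows "path_le E u v (10 * t' * (qside P / 2 ^ D))"
proof -
  let ?w = "qside P / 2 ^ D"
  have uv: "u \<in> P" "v \<in> P" using u v by (auto simp: cell_pts_def split: prod.splits)
  have w: "0 \<le> ?w" using in_root_square[OF assms(1) uv(1)] by simp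
  have duv: "dist u v \<le> 2 * ?w" by (rule same_cell_imp_close[OF assms(1) uv same])
  consider "c = c'" | "D \<le> fst c" "D \<le> fst c'"
    using leaf_eq_or_deeper[OF leaf[OF u(1)] leaf[OF v(1)] u(2) v(2) same] by auto
  then show ?thesis
  proof cases
    case 1
    have "t * dist u v \<le> t' * (2 * ?w)"
      using assms(2,3) duv by (intro mult_mono) auto
    also have "\<dots> \<le> 10 * t' * ?w"
      unfolding mult.assoc[symmetric] using assms(2,3) w by (intro mult_right_mono) auto
    finally show ?thesis
      using greedy[OF u(1,2)] v(2) 1 by (blast intro: path_le_mono)
  next
    case 2
    have close: "dist u (ldr c) \<le> 2 * ?w" "dist (ldr c') v \<le> 2 * ?w"
      using leaf_close[OF assms(1) u(2) ldr[OF u(1)] 2(1)]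
        leaf_close[OF assms(1) ldr[OF v(1)] v(2) 2(2)] by simp_all
    have "dist (ldr c) (ldr c') \<le> dist (ldr c) u + dist u v + dist v (ldr c')"
      using dist_triangle[of "ldr c" "ldr c'" u] dist_triangle[of u "ldr c'" v] by simp
    then have "dist (ldr c) (ldr c') \<le> 6 * ?w"
      using close duv by (simp add: dist_commute)
    then have p2: "path_le E (ldr c) (ldr c') (t' * (6 * ?w))"
      using assms(2,3) by (intro path_le_mono[OF leaders[OF u(1) v(1)] order_refl] mult_left_mono) auto
    have p1: "path_le E u (ldr c) (t' * (2 * ?w))"
      using assms(2,3) close
      by (intro path_le_mono[OF greedy[OF u ldr[OF u(1)]] order_refl] mult_mono) auto
    have p3: "path_le E (ldr c') v (t' * (2 * ?w))"
      using assms(2,3) close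
      by (intro path_le_mono[OF greedy[OF v(1) ldr[OF v(1)] v(2)] order_refl] mult_mono) auto
    have "path_le E u (ldr c') (t' * (8 * ?w))"
      by (rule path_le_trans[OF p1 p2]) (simp add: algebra_simps)
    then show ?thesis
      by (rule path_le_trans[OF _ p3]) (simp add: algebra_simps)
  qed
qed

section \<open>Charging edges to net points\<close>

text \<open>Farthest-first insertion: \<open>r w\<close> is the distance of \<open>w\<close> to the points inserted before it.
  Then \<open>{w \<in> P. \<rho> < r w}\<close> is a \<open>\<rho>\<close>-net of \<open>P\<close> for every scale \<open>\<rho>\<close>, and these nets are nested.\<close>

lemma exists_net_radii:
  fixes P :: "'a :: metric_space set"
  assumes "finite P" and R: "\<And>x y. x \<in> P \<Longrightarrow> y \<in> P \<Longrightarrow> dist x y \<le> R"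
  obtains r where "\<And>w x. w \<in> P \<Longrightarrow> x \<in> P \<Longrightarrow> w \<noteq> x \<Longrightarrow> min (r w) (r x) \<le> dist w x"
    and "\<And>p \<rho>. p \<in> P \<Longrightarrow> 0 < \<rho> \<Longrightarrow> \<rho> < R \<Longrightarrow> \<exists>q\<in>P. \<rho> < r q \<and> dist p q \<le> \<rho>"
proof -
  \<comment> \<open>\<open>S\<close> holds the points inserted so far and \<open>D\<close> is the
    last insertion radius. The final clause is the net property for scales from \<open>D\<close>
    upwards; smaller scales follow as \<open>S\<close> grows.\<close>
  define inv where "inv S r D \<longleftrightarrow> S \<subseteq> P \<and> S \<noteq> {} \<and>
      (\<forall>w\<in>S. \<forall>x\<in>S. w \<noteq> x \<longrightarrow> min (r w) (r x) \<le> dist w x) \<and>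
      (\<forall>w\<in>S. D \<le> r w) \<and> 0 < D \<and> (\<forall>p\<in>P. \<exists>q\<in>S. dist p q \<le> D) \<and>
      (\<forall>p\<in>P. \<forall>\<rho>. D \<le> \<rho> \<and> \<rho> < R \<longrightarrow> (\<exists>q\<in>S. \<rho> < r q \<and> dist p q \<le> \<rho>))" for S r D
  have ex: "\<exists>S r D. inv S r D \<and> card S = Suc n" if "Suc n \<le> card P" for n
    using that
  proof (induction n)
    case 0
    then obtain p where p: "p \<in> P" by fastforce
    \<comment> \<open>A radius of at least \<open>R\<close> makes the net clause vacuous; the 1
      keeps it positive.\<close>
    have "inv {p} (\<lambda>_. max R 1) (max R 1)"
      using p R by (auto simp: inv_def le_max_iff_disj)
    then show ?case by (intro exI) auto
  next
    case (Suc n)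
    then obtain S r D where I: "inv S r D" and card: "card S = Suc n" by auto
    then have S: "S \<subseteq> P" "S \<noteq> {}" and sepS: "\<And>w x. w \<in> S \<Longrightarrow> x \<in> S \<Longrightarrow> w \<noteq> x \<Longrightarrow> min (r w) (r x) \<le> dist w x"
      and D: "\<And>w. w \<in> S \<Longrightarrow> D \<le> r w" "\<And>p. p \<in> P \<Longrightarrow> \<exists>q\<in>S. dist p q \<le> D"
      and netS: "\<And>p \<rho>. p \<in> P \<Longrightarrow> D \<le> \<rho> \<Longrightarrow> \<rho> < R \<Longrightarrow> \<exists>q\<in>S. \<rho> < r q \<and> dist p q \<le> \<rho>"
      unfolding inv_def by simp_all
    have "finite S" using S(1) \<open>finite P\<close> by (rule finite_subset)
    define f where "f p = Min (dist p ` S)" for p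
    have f_le: "f p \<le> dist p q" if "q \<in> S" for p q
      using that \<open>finite S\<close> by (simp add: f_def)
    have f_ex: "\<exists>q\<in>S. dist p q = f p" for p
    proof -
      have "f p \<in> dist p ` S" unfolding f_def using S \<open>finite S\<close> by (intro Min_in) auto
      then obtain q where "Min (dist p ` S) = dist p q" "q \<in> S"
        unfolding f_def by (rule imageE)
      then show ?thesis unfolding f_def by (intro bexI[of _ q]) simp_all
    qed
    have "S \<noteq> P" using card Suc.prems by auto
    then have "f ` (P - S) \<noteq> {}" "finite (f ` (P - S))" using S(1) \<open>finite P\<close> by auto
    then have mx: "f x \<le> Max (f ` (P - S))" if "x \<in> P - S" for x
      using that by (intro Max_ge) auto
    have "Max (f ` (P - S)) \<in> f ` (P - S)"
      using \<open>f ` (P - S) \<noteq> {}\<close> \<open>finite (f ` (P - S))\<close> by (intro Max_in)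
    then obtain p where "p \<in> P - S" and "Max (f ` (P - S)) = f p"
      by (rule imageE)
    then have p: "p \<in> P" "p \<notin> S" by simp_all
    from mx \<open>Max (f ` (P - S)) = f p\<close> have far: "\<And>x. x \<in> P - S \<Longrightarrow> f x \<le> f p" by simp
    have pos: "0 < f p" 
    proof -
      obtain q where "q \<in> S" "dist p q = f p" using f_ex[of p] by (rule bexE)
      then show ?thesis using p(2) zero_less_dist_iff[of p q] by auto
    qed
    \<comment> \<open>Insertion radii never increase; this nests the nets.\<close>
    have "f p \<le> D" 
    proof -
      obtain q where "q \<in> S" "dist p q \<le> D" using D(2)[OF p(1)] by (rule bexE)
      then show ?thesis using f_le[of q p] by simp
    qed
    have near: "\<exists>q\<in>S. dist x q \<le> f p" if "x \<in> P" for x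
    proof (cases "x \<in> S")
      case True
      then show ?thesis using pos by (intro bexI[of _ x]) auto
    next
      case False
      with that have "f x \<le> f p" using far by blast
      moreover obtain q where "q \<in> S" "dist x q = f x" using f_ex[of x] by (rule bexE)
      ultimately show ?thesis by (intro bexI[of _ q]) simp_all
    qed
    define r' where "r' = r(p := f p)"
    have r'[simp]: "r' p = f p" "\<And>q. q \<in> S \<Longrightarrow> r' q = r q"
      using p(2) by (auto simp: r'_def)
    have "inv (insert p S) r' (f p)"
      unfolding inv_def
    proof (intro conjI ballI allI impI)
      fix w x assume wx: "w \<in> insert p S" "x \<in> insert p S" "w \<noteq> x"
      then consider "w \<in> S" "x \<in> S" | "w = p" "x \<in> S" | "x = p" "w \<in> S" by blast
      then show "min (r' w) (r' x) \<le> dist w x"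
      proof cases
        case 1
        then have "min (r w) (r x) \<le> dist w x" using sepS wx(3) by blast
        with 1 show ?thesis by simp
      qed (use f_le[of x p] f_le[of w p] in \<open>simp_all add: min_le_iff_disj dist_commute[of w]\<close>)
    next
      fix x \<rho> assume x: "x \<in> P" and \<rho>: "f p \<le> \<rho> \<and> \<rho> < R"
      show "\<exists>q\<in>insert p S. \<rho> < r' q \<and> dist x q \<le> \<rho>"
      \<comment> \<open>For scales from \<open>f p\<close> up to \<open>D\<close>, all earlier
        points have radius above the scale and already cover \<open>P\<close> within
        \<open>f p\<close>.\<close>
      proof (cases "D \<le> \<rho>")
        case True
        then obtain q where "q \<in> S" "\<rho> < r q" "dist x q \<le> \<rho>" using netS[OF x] \<rho> by blast
        then show ?thesis by (intro bexI[of _ q]) auto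
      next
        case False
        obtain q where q: "q \<in> S" "dist x q \<le> f p" using near[OF x] by blast
        moreover have "D \<le> r q" using D(1) q(1) .
        ultimately show ?thesis using False \<rho> by (intro bexI[of _ q]) auto
      qed
    next
      fix x assume "x \<in> P"
      then show "\<exists>q\<in>insert p S. dist x q \<le> f p" using near by blast
    next
      fix w assume "w \<in> insert p S"
      then show "f p \<le> r' w" using D(1) \<open>f p \<le> D\<close> by (auto intro: order_trans)
    qed (use S p pos in auto)
    moreover have "card (insert p S) = Suc (Suc n)" using card \<open>finite S\<close> p(2) by simp
    ultimately show ?case by blast
  qed
  show thesis
  proof (cases "P = {}")
    case True
    then show thesis using that by blast
  next
    case False
    then obtain n where n: "card P = Suc n"
      using \<open>finite P\<close> by (metis card_eq_0_iff not0_implies_Suc)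
    obtain S r D where I: "inv S r D" "card S = Suc n" using ex[of n] n by auto
    have "S = P" using I \<open>finite P\<close> n unfolding inv_def by (metis card_subset_eq)
    show thesis
    proof (rule that)
      fix w x assume "w \<in> P" "x \<in> P" "w \<noteq> x"
      then show "min (r w) (r x) \<le> dist w x" using I(1) \<open>S = P\<close> unfolding inv_def by blast
    next
      fix p \<rho> assume p: "p \<in> P" and \<rho>: "0 < \<rho>" "\<rho> < R"
      show "\<exists>q\<in>P. \<rho> < r q \<and> dist p q \<le> \<rho>"
      proof (cases "D \<le> \<rho>")
        case True
        then show ?thesis using I(1) p \<rho>(2) unfolding inv_def \<open>S = P\<close> by blast
      next
        \<comment> \<open>Below the last radius every point is its own net point.\<close>
        case False
        moreover have "D \<le> r p" using I(1) p unfolding inv_def \<open>S = P\<close> by blast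
        ultimately show ?thesis using p \<rho>(1) by (intro bexI[of _ p]) auto
      qed
    qed
  qed
qed

text \<open>Net points \<open>x\<close>, \<open>y\<close> near \<open>u\<close>, \<open>v\<close> at
  scale \<open>dist u v / 4\<close> are distinct, so the smaller of their radii is at most
  \<open>dist x y\<close>, hence at most 1/4 + 1 + 1/4 times \<open>dist u v\<close>. The point with
  that radius is charged.\<close>

lemma exists_charging_radii:
  fixes P :: "'a :: metric_space set"
  assumes "finite P"
  obtains r where "\<And>u v. u \<in> P \<Longrightarrow> v \<in> P \<Longrightarrow> u \<noteq> v \<Longrightarrow> \<exists>w\<in>P. dist u v / 4 < r w \<and>
      r w \<le> 3 / 2 * dist u v \<and> dist w u \<le> 5 / 4 * dist u v \<and> dist w v \<le> 5 / 4 * dist u v"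
proof -
  have R: "dist x y \<le> diameter P" if "x \<in> P" "y \<in> P" for x y
    using that assms by (intro diameter_bounded_bound finite_imp_bounded)
  obtain r where r: "\<And>w x. w \<in> P \<Longrightarrow> x \<in> P \<Longrightarrow> w \<noteq> x \<Longrightarrow> min (r w) (r x) \<le> dist w x"
    and net: "\<And>p \<rho>. p \<in> P \<Longrightarrow> 0 < \<rho> \<Longrightarrow> \<rho> < diameter P \<Longrightarrow> \<exists>q\<in>P. \<rho> < r q \<and> dist p q \<le> \<rho>"
    using exists_net_radii[OF assms R] by blast
  show thesis
  proof (rule that)
    fix u v assume uv: "u \<in> P" "v \<in> P" "u \<noteq> v"
    then have l: "0 < dist u v / 4" "dist u v / 4 < diameter P"
      using R[OF uv(1,2)] zero_less_dist_iff[of u v] by linarith+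
    obtain x where x: "x \<in> P" "dist u v / 4 < r x" "dist u x \<le> dist u v / 4"
      using net[OF uv(1) l] by blast
    obtain y where y: "y \<in> P" "dist u v / 4 < r y" "dist v y \<le> dist u v / 4"
      using net[OF uv(2) l] by blast
    have "x \<noteq> y"
      using x(3) y(3) l(1) dist_triangle2[of u v x] by fastforce
    have "dist x y \<le> dist u x + dist u y" "dist u y \<le> dist u v + dist v y"
      "dist x v \<le> dist u x + dist u v"
      using dist_triangle3[of x y u] dist_triangle[of u y v] dist_triangle3[of x v u] by auto
    then have len: "dist x y \<le> 3 / 2 * dist u v" "dist y u \<le> 5 / 4 * dist u v"
      "dist x v \<le> 5 / 4 * dist u v" "dist x u \<le> 5 / 4 * dist u v" "dist y v \<le> 5 / 4 * dist u v"
      using x(3) y(3) l(1) dist_commute[of x u] dist_commute[of y v] dist_commute[of y u] by linarith+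
    show "\<exists>w\<in>P. dist u v / 4 < r w \<and> r w \<le> 3 / 2 * dist u v \<and>
        dist w u \<le> 5 / 4 * dist u v \<and> dist w v \<le> 5 / 4 * dist u v"
    proof (cases "r x \<le> r y")
      case True
      have "r x \<le> dist x y" using r[OF x(1) y(1) \<open>x \<noteq> y\<close>] True by simp
      then show ?thesis using x(1,2) len by (intro bexI[of _ x] conjI) linarith+
    next
      case False
      have "r y \<le> dist x y" using r[OF x(1) y(1) \<open>x \<noteq> y\<close>] False by simp
      then show ?thesis using y(1,2) len by (intro bexI[of _ y] conjI) linarith+
    qed
  qed
qed

text \<open>If this failed for two merge edges, the earlier would supply a \<open>t\<close>-path for
  the later. Ordered pairs fix which endpoints are matched; treating both lengths alike makes the
  relation symmetric.\<close>

definition cells_separate :: "pt set \<Rightarrow> real \<Rightarrow> pt \<times> pt \<Rightarrow> pt \<times> pt \<Rightarrow> bool" where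
  "cells_separate P \<epsilon> e e' \<longleftrightarrow> (\<forall>D. cell_of P D (fst e) = cell_of P D (fst e') \<longrightarrow>
     cell_of P D (snd e) = cell_of P D (snd e') \<longrightarrow>
     qside P / 2 ^ D \<le> \<epsilon> * dist (fst e) (snd e) \<longrightarrow>
     \<not> qside P / 2 ^ D \<le> \<epsilon> * dist (fst e') (snd e'))"

section \<open>Grid scales and the packing of separated pairs\<close>

lemma exists_grid_depth:
  fixes s g :: real
  assumes "0 \<le> s" "0 < g"
  obtains D :: nat where "s / 2 ^ D \<le> g" "D = 0 \<or> g < 2 * (s / 2 ^ D)"
proof -
  obtain n where n: "s / g < 2 ^ n" using real_arch_pow[of 2 "s / g"] by auto
  then have ex: "s / 2 ^ n \<le> g"
    using assms(2) by (simp add: pos_divide_less_eq pos_divide_le_eq mult.commute)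
  \<comment> \<open>At the least such depth, unless it is 0, the parent cells are too coarse; this
    bounds the side from below.\<close>
  define D where "D = (LEAST D. s / 2 ^ D \<le> g)"
  have "s / 2 ^ D \<le> g" unfolding D_def using ex by (rule LeastI[where P = "\<lambda>D. s / 2 ^ D \<le> g"])
  moreover have "D = 0 \<or> g < 2 * (s / 2 ^ D)"
  proof (cases D)
    case (Suc m)
    have "\<not> s / 2 ^ m \<le> g"
      using not_less_Least[of m "\<lambda>D. s / 2 ^ D \<le> g"] Suc unfolding D_def[symmetric] by simp
    then show ?thesis by (simp add: Suc)
  qed simp
  ultimately show thesis by (rule that)
qed

text \<open>Depth 0 has a single index. At other depths \<open>g\<close> is below two sides, so
  \<open>K * g\<close> spans at most \<open>2 * K\<close> sides, and rounding adds one.\<close>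

lemma grid_index_offset:
  assumes "0 < s" "D = 0 \<or> g < 2 * (s / 2 ^ D)" "0 < g" "\<bar>x - y\<bar> \<le> K * g"
  shows "int (grid_index s D x) - int (grid_index s D y) \<in> {- \<lceil>2 * K + 1\<rceil> .. \<lceil>2 * K + 1\<rceil>}"
proof -
  have "0 \<le> K * g" using assms(4) by linarith
  with \<open>0 < g\<close> have K: "0 \<le> K" by (simp add: zero_le_mult_iff)
  have "real_of_int \<bar>int (grid_index s D x) - int (grid_index s D y)\<bar> \<le> 2 * K + 1"
  proof (cases "D = 0")
    case True
    with K show ?thesis by (simp add: grid_index_def)
  next
    case False
    let ?w = "s / 2 ^ D"
    have "0 < ?w" using assms(1) by simp
    have "\<bar>x - y\<bar> \<le> 2 * K * ?w"
    proof -
      have "K * g \<le> K * (2 * ?w)" using assms(2) False K by (intro mult_left_mono) auto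
      also have "\<dots> = 2 * K * ?w" by simp
      finally show ?thesis using assms(4) by linarith
    qed
    then have "\<bar>x - y\<bar> / ?w \<le> 2 * K"
      using \<open>0 < ?w\<close> pos_divide_le_eq by blast
    then show ?thesis
      using grid_index_Lipschitz[OF assms(1), of D x y] by linarith
  qed
  then have "\<bar>int (grid_index s D x) - int (grid_index s D y)\<bar> \<le> \<lceil>2 * K + 1\<rceil>"
    by linarith
  then show ?thesis by auto
qed

text \<open>A pair charged to \<open>w\<close> has length \<open>\<Theta>(r w)\<close> and lies in a ball of radius \<open>O(r w)\<close> around \<open>w\<close>,
  which meets boundedly many cells of side \<open>\<Theta>(\<epsilon> * r w)\<close>; no two pairs share their two cells.\<close>

lemma card_cells_separate_le:
  assumes "finite P" "0 < \<epsilon>" "F \<subseteq> P \<times> P" "\<And>e. e \<in> F \<Longrightarrow> fst e \<noteq> snd e"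
    and sep: "\<And>e e'. e \<in> F \<Longrightarrow> e' \<in> F \<Longrightarrow> e \<noteq> e' \<Longrightarrow> cells_separate P \<epsilon> e e'"
  shows "card F \<le> card P * card {- \<lceil>15 / \<epsilon> + 1\<rceil> .. \<lceil>15 / \<epsilon> + 1\<rceil>} ^ 4"
proof -
  let ?J = "{- \<lceil>15 / \<epsilon> + 1\<rceil> .. \<lceil>15 / \<epsilon> + 1\<rceil>}"
  obtain r where r: "\<And>u v. u \<in> P \<Longrightarrow> v \<in> P \<Longrightarrow> u \<noteq> v \<Longrightarrow> \<exists>w\<in>P. dist u v / 4 < r w \<and>
      r w \<le> 3 / 2 * dist u v \<and> dist w u \<le> 5 / 4 * dist u v \<and> dist w v \<le> 5 / 4 * dist u v"
    using exists_charging_radii[OF assms(1)] by blast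
  have "\<forall>e\<in>F. \<exists>w\<in>P. dist (fst e) (snd e) / 4 < r w \<and> r w \<le> 3 / 2 * dist (fst e) (snd e) \<and>
      dist w (fst e) \<le> 5 / 4 * dist (fst e) (snd e) \<and> dist w (snd e) \<le> 5 / 4 * dist (fst e) (snd e)"
    using assms(3,4) by (intro ballI r) auto
  then obtain w where w: "\<And>e. e \<in> F \<Longrightarrow> w e \<in> P \<and>
      dist (fst e) (snd e) / 4 < r (w e) \<and> r (w e) \<le> 3 / 2 * dist (fst e) (snd e) \<and>
      dist (w e) (fst e) \<le> 5 / 4 * dist (fst e) (snd e) \<and> dist (w e) (snd e) \<le> 5 / 4 * dist (fst e) (snd e)"
    by metis
  \<comment> \<open>The 2/3 cancels the 3/2 in the bound on \<open>r (w e)\<close>, so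
    \<open>g e\<close> is at most \<open>\<epsilon>\<close> times the length of each edge charged to
    \<open>w e\<close>.\<close>
  define g where "g e = 2 / 3 * \<epsilon> * r (w e)" for e
  \<comment> \<open>The depth depends on the charged point alone, so all edges charged to it are
    compared at one depth.\<close>
  have "\<exists>D. \<forall>p. 0 < qside P \<longrightarrow> 0 < r p \<longrightarrow> qside P / 2 ^ D p \<le> 2 / 3 * \<epsilon> * r p \<and>
      (D p = 0 \<or> 2 / 3 * \<epsilon> * r p < 2 * (qside P / 2 ^ D p))"
    by (rule choice) (metis exists_grid_depth less_imp_le mult_pos_pos assms(2) zero_less_divide_iff zero_less_numeral)
  then obtain D where D: "\<And>p. 0 < qside P \<Longrightarrow> 0 < r p \<Longrightarrow> qside P / 2 ^ D p \<le> 2 / 3 * \<epsilon> * r p"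
    "\<And>p. 0 < qside P \<Longrightarrow> 0 < r p \<Longrightarrow> D p = 0 \<or> 2 / 3 * \<epsilon> * r p < 2 * (qside P / 2 ^ D p)"
    by blast
  define off where "off c q = (int (fst c) - int (fst q), int (snd c) - int (snd q))" for c q :: "nat \<times> nat"
  \<comment> \<open>Offsets from the cell of the charged point take boundedly many values and, given
    that point, determine the cells of both endpoints.\<close>
  define code where "code e = (w e, off (cell_of P (D (w e)) (fst e)) (cell_of P (D (w e)) (w e)),
      off (cell_of P (D (w e)) (snd e)) (cell_of P (D (w e)) (w e)))" for e
  have qpos: "0 < qside P" if "e \<in> F" for e
    using qside_pos[OF assms(1), of "fst e" "snd e"] assms(3,4) that by auto
  have rpos: "0 < r (w e)" if "e \<in> F" for e
    using w[OF that] assms(4)[OF that] by (smt (verit) zero_less_dist_iff divide_pos_pos)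
  have offset: "off (cell_of P (D (w e)) p) (cell_of P (D (w e)) (w e)) \<in> ?J \<times> ?J"
    if e: "e \<in> F" and p: "dist (w e) p \<le> 5 / 4 * dist (fst e) (snd e)" for e p
  proof -
    \<comment> \<open>The edge is shorter than \<open>4 * r (w e)\<close>. In units of
      \<open>g e\<close> this gives \<open>K = 15 / (2 * \<epsilon>)\<close>, and
      \<open>2 * K + 1\<close> is the bound in \<open>?J\<close>.\<close>
    have "dist (w e) p \<le> 5 * r (w e)" using w[OF e] p by linarith
    also have "\<dots> = 15 / (2 * \<epsilon>) * g e" using assms(2) by (simp add: g_def)
    finally have near: "\<bar>fst p - fst (w e)\<bar> \<le> 15 / (2 * \<epsilon>) * g e" "\<bar>snd p - snd (w e)\<bar> \<le> 15 / (2 * \<epsilon>) * g e"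
      using abs_diffs_le_dist[of p "w e"] by (auto simp: dist_commute)
    have g: "0 < g e" using rpos[OF e] assms(2) by (simp add: g_def)
    have D': "D (w e) = 0 \<or> g e < 2 * (qside P / 2 ^ D (w e))"
      using D(2)[OF qpos[OF e] rpos[OF e]] by (simp add: g_def)
    show ?thesis
      using grid_index_offset[OF qpos[OF e] D' g, of "fst p - qx0 P" "fst (w e) - qx0 P" "15 / (2 * \<epsilon>)"]
        grid_index_offset[OF qpos[OF e] D' g, of "snd p - qy0 P" "snd (w e) - qy0 P" "15 / (2 * \<epsilon>)"] near
      by (simp add: off_def cell_of_eq_grid_index)
  qed
  have "inj_on code F"
  proof (rule inj_onI, rule ccontr)
    fix e e' assume e: "e \<in> F" "e' \<in> F" and code: "code e = code e'" and "e \<noteq> e'"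
    have eq: "w e' = w e" using code by (simp add: code_def)
    have "cell_of P (D (w e)) (fst e) = cell_of P (D (w e)) (fst e')"
      "cell_of P (D (w e)) (snd e) = cell_of P (D (w e)) (snd e')"
      using code by (auto simp: code_def off_def eq prod_eq_iff)
    moreover have "qside P / 2 ^ D (w e) \<le> \<epsilon> * dist (fst f) (snd f)" if "f \<in> F" "w f = w e" for f
    proof -
      have "qside P / 2 ^ D (w e) \<le> \<epsilon> * (2 / 3 * r (w e))"
        using D(1)[OF qpos[OF e(1)] rpos[OF e(1)]] by simp
      also have "\<dots> \<le> \<epsilon> * dist (fst f) (snd f)"
        using w[OF that(1)] assms(2) unfolding that(2) by (intro mult_left_mono) auto
      finally show ?thesis .
    qed
    ultimately show False
      using sep[OF e \<open>e \<noteq> e'\<close>] e eq unfolding cells_separate_def by blast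
  qed
  moreover have "code ` F \<subseteq> P \<times> (?J \<times> ?J) \<times> (?J \<times> ?J)"
  proof
    fix y assume "y \<in> code ` F"
    then obtain e where "e \<in> F" "y = code e" by blast
    then show "y \<in> P \<times> (?J \<times> ?J) \<times> (?J \<times> ?J)"
      using w[of e] offset[of e "fst e"] offset[of e "snd e"]
      unfolding \<open>y = code e\<close> code_def by (intro SigmaI) blast+
  qed
  ultimately have "card F \<le> card (P \<times> (?J \<times> ?J) \<times> (?J \<times> ?J))"
    using assms(1) by (intro card_inj_on_le) auto
  also have "\<dots> = card P * card ?J ^ 4"
    by (simp only: card_cartesian_product) (simp add: power4_eq_xxxx mult.assoc)
  finally show ?thesis .
qed

section \<open>Merging\<close>

definition pair_edges :: "pt set \<Rightarrow> pt set set" where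
  "pair_edges P = {{p, q} | p q. p \<in> P \<and> q \<in> P \<and> p \<noteq> q}"

lemma pair_edges_mono: "Q \<subseteq> P \<Longrightarrow> pair_edges Q \<subseteq> pair_edges P"
  unfolding pair_edges_def by blast

lemma card_pair_edges_le:
  assumes "finite Q" "E \<subseteq> pair_edges Q"
  shows "card E \<le> card Q ^ 2"
proof -
  have "E \<subseteq> (\<lambda>(p, q). {p, q}) ` (Q \<times> Q)" using assms(2) by (auto simp: pair_edges_def)
  then have "card E \<le> card (Q \<times> Q)" using assms(1) by (intro surj_card_le) auto
  then show ?thesis by (simp add: card_cartesian_product power2_eq_square)
qed

text \<open>The invariant of merging. \<open>F\<close> keeps every inserted edge in the orientation
  in which it was processed, as \<open>cells_separate\<close> requires.\<close>

definition sparse_extension :: "pt set \<Rightarrow> real \<Rightarrow> pt set \<Rightarrow> pt set set \<Rightarrow> pt set set \<Rightarrow> bool" where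
  "sparse_extension P \<epsilon> U E0 E \<longleftrightarrow> (\<exists>F \<subseteq> U \<times> U. E = E0 \<union> (\<lambda>(p, q). {p, q}) ` F \<and>
     (\<forall>e\<in>F. fst e \<noteq> snd e) \<and> (\<forall>e\<in>F. \<forall>e'\<in>F. e \<noteq> e' \<longrightarrow> cells_separate P \<epsilon> e e'))"

lemma run_invariant:
  assumes "run step s xs s'" "I s" "\<And>s x s'. x \<in> set xs \<Longrightarrow> I s \<Longrightarrow> step s x s' \<Longrightarrow> I s'"
  shows "I s'"
  using assms by (induction rule: run.induct) auto

text \<open>The interface between the initial graph and the merging: \<open>E0\<close> stands for
  the greedy and WSPD edges, \<open>U\<close> for the points of the nonempty leaves, and
  \<open>short\<close> summarises the walks through leaders.\<close>

locale local_paths =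
  fixes P :: "pt set" and t t' :: real and U :: "pt set" and E0 :: "pt set set"
  assumes fin: "finite P" and t: "1 < t" "t \<le> t'" and U: "U \<subseteq> P"
    and short: "\<And>u v D. u \<in> U \<Longrightarrow> v \<in> U \<Longrightarrow> cell_of P D u = cell_of P D v
      \<Longrightarrow> path_le E0 u v (10 * t' * (qside P / 2 ^ D))"
begin

text \<open>The 24 adds up two detours of \<open>10 * t'\<close> cell sides and at most 4 sides of
  extra length on the middle edge.\<close>

definition \<epsilon> :: real where "\<epsilon> = (t - 1) / (24 * t')"

lemma \<epsilon>_pos: "0 < \<epsilon>"
  using t by (simp add: \<epsilon>_def)

text \<open>The detour over \<open>{x, y}\<close> begins and ends inside common cells; by the choice
  of \<open>\<epsilon>\<close> its excess over \<open>dist u v\<close> is at most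
  \<open>(t - 1) * dist u v\<close>.\<close>

lemma path_via_edge:
  assumes "E0 \<subseteq> E" "{x, y} \<in> E" and mem: "u \<in> U" "v \<in> U" "x \<in> U" "y \<in> U"
    and same: "cell_of P D u = cell_of P D x" "cell_of P D v = cell_of P D y"
    and small: "qside P / 2 ^ D \<le> \<epsilon> * dist u v"
  shows "path_le E u v (t * dist u v)"
proof -
  define w where "w = qside P / 2 ^ D"
  have P: "u \<in> P" "v \<in> P" "x \<in> P" "y \<in> P" using mem U by blast+
  have w: "0 \<le> w" using in_root_square[OF fin P(1)] by (simp add: w_def)
  have close: "dist x u \<le> 2 * w" "dist v y \<le> 2 * w"
    using same_cell_imp_close[OF fin P(1,3) same(1)] same_cell_imp_close[OF fin P(2,4) same(2)]
    by (simp_all add: w_def dist_commute)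
  have "24 * t' * w \<le> 24 * t' * (\<epsilon> * dist u v)"
    using small t by (intro mult_left_mono) (simp_all add: w_def)
  also have "\<dots> = (t - 1) * dist u v" using t by (simp add: \<epsilon>_def)
  finally have "24 * t' * w \<le> t * dist u v - dist u v" by (simp add: left_diff_distrib)
  then have budget: "24 * (t' * w) + dist u v \<le> t * dist u v" unfolding mult.assoc by linarith
  \<comment> \<open>This absorbs the \<open>4 * w\<close> by which \<open>{x, y}\<close> may exceed
    \<open>dist u v\<close> into \<open>4 * t' * w\<close>.\<close>
  have "1 * w \<le> t' * w" using t w by (intro mult_right_mono) auto
  moreover have "dist x y \<le> dist x u + dist u v + dist v y"
    using dist_triangle[of x y u] dist_triangle[of u y v] by simp
  ultimately have len: "dist x y + 20 * (t' * w) \<le> t * dist u v"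
    using close budget unfolding mult_1 by linarith
  have p1: "path_le E u x (10 * t' * w)"
    by (rule path_le_mono[OF short[OF mem(1,3) same(1), folded w_def] assms(1) order_refl])
  have "path_le E v y (10 * t' * w)"
    by (rule path_le_mono[OF short[OF mem(2,4) same(2), folded w_def] assms(1) order_refl])
  then have "path_le E y v (10 * t' * w)"
    by (rule path_le_sym)
  then have "path_le E x v (dist x y + 10 * t' * w)"
    by (rule path_le_Cons[OF assms(2)]) simp
  then show ?thesis
    by (rule path_le_trans[OF p1]) (use len in \<open>unfold mult.assoc, linarith\<close>)
qed

text \<open>Were the new edge not separated from an earlier one, \<open>path_via_edge\<close> would
  produce the very path whose absence is assumed.\<close>

lemma sparse_extension_insert:
  assumes ext: "sparse_extension P \<epsilon> U E0 E" and uv: "u \<in> U" "v \<in> U"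
    and no_path: "\<not> path_le E u v (t * dist u v)"
  shows "sparse_extension P \<epsilon> U E0 (insert {u, v} E)"
proof -
  obtain F where F: "F \<subseteq> U \<times> U" "E = E0 \<union> (\<lambda>(p, q). {p, q}) ` F" "\<forall>e\<in>F. fst e \<noteq> snd e"
    "\<forall>e\<in>F. \<forall>e'\<in>F. e \<noteq> e' \<longrightarrow> cells_separate P \<epsilon> e e'"
    using ext by (auto simp: sparse_extension_def)
  have ne: "u \<noteq> v" using no_path path_le_refl[of 0 E u] by auto
  have new: "cells_separate P \<epsilon> (u, v) e" "cells_separate P \<epsilon> e (u, v)" if "e \<in> F" for e
  proof -
    have e: "{fst e, snd e} \<in> E" "fst e \<in> U" "snd e \<in> U"
      using that F(1,2) by (auto simp: case_prod_unfold)
    \<comment> \<open>The contradiction comes from the length of the new edge alone, so it settles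
      both orders of the pair.\<close>
    have "\<not> qside P / 2 ^ D \<le> \<epsilon> * dist u v"
      if "cell_of P D u = cell_of P D (fst e)" "cell_of P D v = cell_of P D (snd e)" for D
      using path_via_edge[OF _ e(1) uv e(2,3) that] no_path F(2) by blast
    then show "cells_separate P \<epsilon> (u, v) e" "cells_separate P \<epsilon> e (u, v)"
      unfolding cells_separate_def fst_conv snd_conv by metis+
  qed
  show ?thesis
    unfolding sparse_extension_def
    using F new uv ne by (intro exI[of _ "insert (u, v) F"]) auto
qed

text \<open>\<open>bridge_step\<close> inserts an edge only if the current graph has no
  \<open>t\<close>-path for it, so \<open>sparse_extension_insert\<close> applies to every
  insertion.\<close>

lemma sparse_extension_merges:
  assumes "run (merge_step P t ldr) E0 ms H"
    and "\<And>c c'. (c, c') \<in> set ms \<Longrightarrow> cell_pts P c \<subseteq> U \<and> cell_pts P c' \<subseteq> U"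
  shows "sparse_extension P \<epsilon> U E0 H"
  using assms(1)
proof (rule run_invariant)
  show "sparse_extension P \<epsilon> U E0 E0" by (auto simp: sparse_extension_def)
next
  fix E cc E' assume "cc \<in> set ms" and E: "sparse_extension P \<epsilon> U E0 E" and "merge_step P t ldr E cc E'"
  moreover obtain c c' where cc: "cc = (c, c')" by (cases cc)
  ultimately obtain us B0 B where us: "set us = cell_pts P c \<times> cell_pts P c'"
    and run: "run (bridge_step t) (E, B0) us (E', B)"
    by (auto simp: merge_step_def)
  have sub: "set us \<subseteq> U \<times> U"
    using assms(2)[of c c'] \<open>cc \<in> set ms\<close> by (auto simp: us cc)
  have "(\<lambda>st. sparse_extension P \<epsilon> U E0 (fst st)) (E', B)"
    using run
  proof (rule run_invariant)
    fix st uv st' assume "uv \<in> set us" and ext: "sparse_extension P \<epsilon> U E0 (fst st)"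
      and step: "bridge_step t st uv st'"
    obtain u v where uv: "uv = (u, v)" by (cases uv)
    have mem: "u \<in> U" "v \<in> U" using sub \<open>uv \<in> set us\<close> uv by auto
    \<comment> \<open>Skipping a pair and recording a found path both keep the edge set.\<close>
    have "fst st' = fst st \<or> fst st' = insert {u, v} (fst st) \<and> \<not> path_le (fst st) u v (t * dist u v)"
      using step unfolding bridge_step_def uv
      by (simp split: prod.splits if_splits) (auto simp del: split_paired_Ex)
    then show "sparse_extension P \<epsilon> U E0 (fst st')"
      using ext sparse_extension_insert[OF ext mem] by metis
  qed (use E in simp)
  then show "sparse_extension P \<epsilon> U E0 E'" by simp
qed

end

section \<open>Counting the edges of the output\<close>

lemma card_sparse_extension_le:
  assumes "finite P" "0 < \<epsilon>" "U \<subseteq> P" "sparse_extension P \<epsilon> U E0 E"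
  shows "card E \<le> card E0 + card P * card {- \<lceil>15 / \<epsilon> + 1\<rceil> .. \<lceil>15 / \<epsilon> + 1\<rceil>} ^ 4"
    and "E0 \<subseteq> pair_edges P \<Longrightarrow> E \<subseteq> pair_edges P"
proof -
  obtain F where F: "F \<subseteq> U \<times> U" "E = E0 \<union> (\<lambda>(p, q). {p, q}) ` F" "\<forall>e\<in>F. fst e \<noteq> snd e"
    "\<forall>e\<in>F. \<forall>e'\<in>F. e \<noteq> e' \<longrightarrow> cells_separate P \<epsilon> e e'"
    using assms(4) by (auto simp: sparse_extension_def)
  have sub: "F \<subseteq> P \<times> P" using F(1) assms(3) by blast
  have "finite F" using finite_subset[OF sub] assms(1) by simp
  have ne: "\<And>e. e \<in> F \<Longrightarrow> fst e \<noteq> snd e" using F(3) by simp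
  have sep: "\<And>e e'. e \<in> F \<Longrightarrow> e' \<in> F \<Longrightarrow> e \<noteq> e' \<Longrightarrow> cells_separate P \<epsilon> e e'" using F(4) by simp
  have "card E \<le> card E0 + card F"
    unfolding F(2) using card_Un_le[of E0 "(\<lambda>(p, q). {p, q}) ` F"]
      card_image_le[OF \<open>finite F\<close>, of "\<lambda>(p, q). {p, q}"] by linarith
  with card_cells_separate_le[OF assms(1,2) sub ne sep]
  show "card E \<le> card E0 + card P * card {- \<lceil>15 / \<epsilon> + 1\<rceil> .. \<lceil>15 / \<epsilon> + 1\<rceil>} ^ 4"
    by (meson add_left_mono order_trans)
  show "E \<subseteq> pair_edges P" if "E0 \<subseteq> pair_edges P"
  proof -
    have "{fst e, snd e} \<in> pair_edges P" if "e \<in> F" for e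
    proof -
      have "fst e \<in> P" "snd e \<in> P" "fst e \<noteq> snd e" using F(3) sub that by auto
      then show ?thesis unfolding pair_edges_def by blast
    qed
    with that show ?thesis unfolding F(2) case_prod_unfold by blast
  qed
qed

text \<open>Distinct leaves share no points. This bounds the number of nonempty leaves by
  \<open>card P\<close>.\<close>

lemma leaders_inj_on:
  assumes "\<And>c. c \<in> nonempty_leaves P k \<Longrightarrow> ldr c \<in> cell_pts P c"
  shows "inj_on ldr (nonempty_leaves P k)"
proof (rule inj_onI)
  fix c c' assume "c \<in> nonempty_leaves P k" "c' \<in> nonempty_leaves P k" "ldr c = ldr c'"
  then show "c = c'"
    using leaf_unique[of P k c c' "ldr c"] assms[of c] assms[of c'] by (simp add: nonempty_leaves_def)
qed

text \<open>The three summands count greedy edges, at most \<open>k ^ 2\<close> per nonempty leaf,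
  then WSPD edges, then edges inserted by merging.\<close>

lemma fss_output_bounds:
  fixes t t' cW :: real
  assumes "1 < t" "t \<le> t'" "finite P" "fss_output P t t' k h cW H"
  defines "\<epsilon> \<equiv> (t - 1) / (24 * t')"
  shows "H \<subseteq> pair_edges P"
    and "real (card H) \<le> (real k ^ 2 + \<bar>cW\<bar> + real (card {- \<lceil>15 / \<epsilon> + 1\<rceil> .. \<lceil>15 / \<epsilon> + 1\<rceil>} ^ 4)) * real (card P)"
proof -
  let ?L = "nonempty_leaves P k" and ?J = "{- \<lceil>15 / \<epsilon> + 1\<rceil> .. \<lceil>15 / \<epsilon> + 1\<rceil>}"
  obtain G ldr ws a b ms where
    greedy: "\<And>c. c \<in> ?L \<Longrightarrow> fg_greedy_out t (cell_pts P c) (G c)"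
    and leader: "\<And>c. c \<in> ?L \<Longrightarrow> is_leader (cell_pts P c) (ldr c)"
    and wspd: "is_wspd (4 * (t' + 1) / (t' - 1)) (ldr ` ?L) ws"
    and size: "real (length ws) \<le> cW * real (card (ldr ` ?L))"
    and ab: "\<forall>i < length ws. a i \<in> fst (ws ! i) \<and> b i \<in> snd (ws ! i)"
    and ms: "set (map (\<lambda>(c, c'). {c, c'}) ms) =
      {{c, c'} | c c' m. c \<in> ?L \<and> c' \<in> ?L \<and> 1 \<le> m \<and> m \<le> h \<and> hop_eq P k m c c'}"
    and run: "run (merge_step P t ldr) ((\<Union>c \<in> ?L. G c) \<union> {{a i, b i} | i. i < length ws}) ms H"
    using assms(4) unfolding fss_output_def by (elim exE conjE) (rule that, simp_all only:)
  let ?G = "\<Union>c \<in> ?L. G c" and ?W = "{{a i, b i} | i. i < length ws}"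
  define U where "U = (\<Union>c \<in> ?L. cell_pts P c)"
  have pts: "cell_pts P c \<subseteq> P" for c by (auto simp: cell_pts_def)
  then have "U \<subseteq> P" by (auto simp: U_def)
  have ldr: "ldr c \<in> cell_pts P c" if "c \<in> ?L" for c
    using leader[OF that] by (simp add: is_leader_def)
  then have ldr_sub: "ldr ` ?L \<subseteq> P" using pts by blast
  have fin_ldr: "finite (ldr ` ?L)" using ldr_sub assms(3) finite_subset by blast
  have inj: "inj_on ldr ?L" using ldr by (rule leaders_inj_on)
  have fin_L: "finite ?L" using fin_ldr inj by (rule finite_imageD)
  have card_ldr: "card (ldr ` ?L) \<le> card P" using ldr_sub assms(3) by (simp add: card_mono)
  then have card_L: "card ?L \<le> card P" by (simp add: card_image[OF inj])
  have G: "G c \<subseteq> pair_edges (cell_pts P c)" if "c \<in> ?L" for c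
    using fg_greedy_subset[OF greedy[OF that]] by (simp add: pair_edges_def)
  have W: "?W \<subseteq> pair_edges P"
  proof
    fix x assume "x \<in> ?W"
    then obtain i where i: "i < length ws" "x = {a i, b i}" by blast
    then have "(fst (ws ! i), snd (ws ! i)) \<in> set ws" by simp
    then have "fst (ws ! i) \<subseteq> ldr ` ?L" "snd (ws ! i) \<subseteq> ldr ` ?L"
      and sep: "well_sep (4 * (t' + 1) / (t' - 1)) (fst (ws ! i)) (snd (ws ! i))"
      using wspd unfolding is_wspd_def by blast+
    then have "a i \<in> P" "b i \<in> P" using ab i(1) ldr_sub by blast+
    \<comment> \<open>The enclosing disks are disjoint, so no WSPD edge is a loop.\<close>
    moreover have "a i \<noteq> b i" using sep ab i(1) unfolding well_sep_def by (metis IntI emptyE subsetD)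
    ultimately show "x \<in> pair_edges P" unfolding i(2) pair_edges_def by blast
  qed
  have W_spanner: "path_le ?W p q (t' * dist p q)" if "p \<in> ldr ` ?L" "q \<in> ldr ` ?L" for p q
    using assms(1,2) by (intro wspd_spanner[OF fin_ldr _ wspd ab that]) simp
  have local: "path_le (?G \<union> ?W) u v (10 * t' * (qside P / 2 ^ D))"
    if uv: "u \<in> U" "v \<in> U" and same: "cell_of P D u = cell_of P D v" for u v D
  proof -
    obtain c c' where c: "c \<in> ?L" "u \<in> cell_pts P c" "c' \<in> ?L" "v \<in> cell_pts P c'"
      using uv by (auto simp: U_def)
    show ?thesis
    proof (rule same_cell_path[OF assms(3) _ assms(2) _ _ ldr _ c same])
      show "1 \<le> t" using assms(1) by simp
      show "path_le (?G \<union> ?W) p q (t * dist p q)" if "c \<in> ?L" "p \<in> cell_pts P c" "q \<in> cell_pts P c" for c p q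
        using fg_greedy_spanner[OF greedy[OF that(1)] _ that(2,3)] assms(1) that(1)
        by (auto intro: path_le_mono)
      show "path_le (?G \<union> ?W) (ldr c) (ldr c') (t' * dist (ldr c) (ldr c'))" if "c \<in> ?L" "c' \<in> ?L" for c c'
        using that by (intro path_le_mono[OF W_spanner]) auto
      show "qt_leaf P k c" if "c \<in> ?L" for c
        using that by (simp add: nonempty_leaves_def)
    qed
  qed
  interpret local_paths P t t' U "?G \<union> ?W"
    by (rule local_paths.intro[OF assms(3,1,2) \<open>U \<subseteq> P\<close> local])
  have \<epsilon>: "local_paths.\<epsilon> t t' = \<epsilon>" unfolding \<epsilon>_def assms(5) ..
  have ext: "sparse_extension P (local_paths.\<epsilon> t t') U (?G \<union> ?W) H"
  proof (rule sparse_extension_merges[OF run])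
    fix c c' assume "(c, c') \<in> set ms"
    then have "{c, c'} \<in> set (map (\<lambda>(c, c'). {c, c'}) ms)" by force
    then have "c \<in> ?L \<and> c' \<in> ?L" unfolding ms by (auto simp: doubleton_eq_iff)
    then show "cell_pts P c \<subseteq> U \<and> cell_pts P c' \<subseteq> U" by (auto simp: U_def)
  qed
  have "G c \<subseteq> pair_edges P" if "c \<in> ?L" for c
    by (rule order_trans[OF G[OF that] pair_edges_mono[OF pts]])
  then have "?G \<union> ?W \<subseteq> pair_edges P" using W by (intro Un_least UN_least)
  then show "H \<subseteq> pair_edges P"
    by (rule card_sparse_extension_le(2)[OF assms(3) \<epsilon>_pos \<open>U \<subseteq> P\<close> ext])
  have card_Gc: "card (G c) \<le> k ^ 2" if "c \<in> ?L" for c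
  proof -
    have "card (G c) \<le> card (cell_pts P c) ^ 2"
      by (rule card_pair_edges_le[OF finite_subset[OF pts assms(3)] G[OF that]])
    also have "card (cell_pts P c) ^ 2 \<le> k ^ 2"
      using that by (intro power_mono) (simp_all add: nonempty_leaves_def qt_leaf_def)
    finally show ?thesis .
  qed
  have "card ?G \<le> (\<Sum>c\<in>?L. card (G c))" by (rule card_UN_le[OF fin_L])
  also have "\<dots> \<le> of_nat (card ?L) * k ^ 2" by (rule sum_bounded_above[OF card_Gc])
  also have "\<dots> = card ?L * k ^ 2" by simp
  also have "\<dots> \<le> card P * k ^ 2" using card_L by (rule mult_right_mono) simp
  finally have "real (card ?G) \<le> real (card P * k ^ 2)" by (rule of_nat_mono)
  then have card_G: "real (card ?G) \<le> real k ^ 2 * real (card P)" by (simp add: mult.commute)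
  have W_image: "?W = (\<lambda>i. {a i, b i}) ` {..<length ws}" by auto
  have "card ?W \<le> length ws"
    unfolding W_image using card_image_le[of "{..<length ws}" "\<lambda>i. {a i, b i}"] by simp
  then have "real (card ?W) \<le> cW * real (card (ldr ` ?L))" using size by linarith
  \<comment> \<open>The sign of \<open>cW\<close> is unrestricted; the absolute value makes the
    bound monotone in the number of leaders.\<close>
  also have "\<dots> \<le> \<bar>cW\<bar> * real (card P)" using card_ldr by (intro mult_mono) auto
  finally have card_W: "real (card ?W) \<le> \<bar>cW\<bar> * real (card P)" .
  have "card H \<le> card ?G + card ?W + card P * card ?J ^ 4"
    using card_sparse_extension_le(1)[OF assms(3) \<epsilon>_pos \<open>U \<subseteq> P\<close> ext] card_Un_le[of ?G ?W]
    unfolding \<epsilon> by linarith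
  then have "real (card H) \<le> real (card ?G + card ?W + card P * card ?J ^ 4)" by (rule of_nat_mono)
  also have "\<dots> = real (card ?G) + real (card ?W) + real (card ?J ^ 4) * real (card P)" by simp
  also have "\<dots> \<le> (real k ^ 2 + \<bar>cW\<bar> + real (card ?J ^ 4)) * real (card P)"
    using card_G card_W by (simp add: distrib_right)
  finally show "real (card H) \<le> (real k ^ 2 + \<bar>cW\<bar> + real (card ?J ^ 4)) * real (card P)" .
qed


theorem theorem1:
  fixes t t' cW :: real and k h :: nat
  assumes "t > 1" and "t' \<ge> t" and "k \<ge> 1" and "h \<ge> 1"
  shows "\<exists>C :: real. \<forall>(P :: pt set) (H :: pt set set).
           finite P \<longrightarrow> fss_output P t t' k h cW H \<longrightarrow>
             H \<subseteq> {{p, q} | p q. p \<in> P \<and> q \<in> P \<and> p \<noteq> q} \<and>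
             real (card H) \<le> C * real (card P)"
proof (intro exI allI impI conjI)
  fix P :: "pt set" and H :: "pt set set"
  assume "finite P" "fss_output P t t' k h cW H"
  note bounds = fss_output_bounds[OF assms(1,2) this]
  show "H \<subseteq> {{p, q} | p q. p \<in> P \<and> q \<in> P \<and> p \<noteq> q}"
    using bounds(1) by (simp add: pair_edges_def)
  \<comment> \<open>This fixes the witness for \<open>C\<close>: it is built from \<open>t\<close>,
    \<open>t'\<close>, \<open>k\<close> and \<open>cW\<close>, independently of \<open>P\<close> and
    \<open>H\<close>.\<close>
  show "real (card H) \<le> (real k ^ 2 + \<bar>cW\<bar> + real (card {- \<lceil>15 / ((t - 1) / (24 * t')) + 1\<rceil> ..
      \<lceil>15 / ((t - 1) / (24 * t')) + 1\<rceil>} ^ 4)) * real (card P)"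
    by (rule bounds(2))
qed

end
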